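(* Let $(Q)$ be a nondeterministic finite automaton over a finite alphabet $\Sigma$ with the interval language $L$, and assume that the graph of $(Q)$ has at least one oriented cycle. Let $(Q_n)$, $n\ge1$, be the cyclic covers of $(Q)$ (associated to an arrangement of the states of $(Q)$ around a circle). Then the automata $(Q_n)$ all have the same interval language $L$. For each $n\geq 1$, the trace language $L_{\circ,(Q_n)}$ does not contain any words of length less than $n$ other than the empty word, and $L_{\circ,(Q_n)}$ is infinite.
   Context: An automaton $(Q)=(Q,\delta,Q_{\mathsf{in}},Q_{\mathsf{t}})$ over $\Sigma$ has a finite set $Q$ of states, transition function $\delta:Q\times\Sigma\to\mathscr{P}(Q)$, and subsets $Q_{\mathsf{in}},Q_{\mathsf{t}}\subset Q$ of initial and accepting states. Its graph has vertex set $Q$ and an oriented edge labelled $a$ from $q$ to $q'$ for each $a\in\Sigma$, $q'\in\delta(q,a)$. An oriented cycle has at least one edge. Cyclic covers: arrange the states of $(Q)$ around a circle and draw each arrow $q\xrightarrow{a}q'$ so that it goes clockwise around the circle, at most one full rotation (an arrow from a state to itself makes exactly one full rotation). The cyclic cover $(Q_n)$ is the covering automaton obtained by pulling back the connected (cyclic) $n$-fold cover of the circle. Explicitly, if $q_1,\dots,q_k$ are the states listed in clockwise order, the states of $(Q_n)$ are pairs $(q_i,r)$ with $r\in\mathbb{Z}/n$; each edge $q_i\xrightarrow{a}q_j$ of $(Q)$ and each $r\in\mathbb{Z}/n$ give an edge labelled $a$ from $(q_i,r)$ to $(q_j,r)$ if $j>i$ and to $(q_j,r+1)$ if $j\le i$;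 and $(q_i,r)$ is initial (respectively accepting) if and only if $q_i$ is. In particular $(Q_1)=(Q)$. The interval language of an automaton consists of words read along some oriented path from an initial to an accepting state. The trace language $L_{\circ,(Q)}$ consists of words $\omega$ such that for some state $q$ there is an oriented path reading $\omega$ that starts and ends at $q$ (length-zero paths, reading the empty word, are allowed). *)

theory Defs
  imports Main
begin

record ('q, 'a) automaton =
  alphabet :: "'a set"
  states :: "'q set"
  delta :: "'q \<Rightarrow> 'a \<Rightarrow> 'q set"
  initial :: "'q set"
  accepting :: "'q set"

(* The transition function matters only on states x alphabet; its values elsewhere are
   unconstrained and are ignored by edges. *)
definition nfa :: "('q, 'a) automaton \<Rightarrow> bool" where
  "nfa A \<longleftrightarrow> finite (alphabet A) \<and> finite (states A) \<and>
     (\<forall>q \<in> states A. \<forall>a \<in> alphabet A. delta A q a \<subseteq> states A) \<and>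
     initial A \<subseteq> states A \<and> accepting A \<subseteq> states A"

definition edges :: "('q, 'a) automaton \<Rightarrow> ('q \<times> 'a \<times> 'q) set" where
  "edges A = {(q, a, q'). q \<in> states A \<and> a \<in> alphabet A \<and> q' \<in> delta A q a}"

(* path A q w q': some oriented path from q to q' in the graph of A reads the word w. *)
inductive path :: "('q, 'a) automaton \<Rightarrow> 'q \<Rightarrow> 'a list \<Rightarrow> 'q \<Rightarrow> bool"
  for A :: "('q, 'a) automaton" where
  empty: "q \<in> states A \<Longrightarrow> path A q [] q"
| step: "(q, a, q') \<in> edges A \<Longrightarrow> path A q' w q'' \<Longrightarrow> path A q (a # w) q''"

definition has_oriented_cycle :: "('q, 'a) automaton \<Rightarrow> bool" where
  "has_oriented_cycle A \<longleftrightarrow> (\<exists>q w. w \<noteq> [] \<and> path A q w q)"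

definition interval_language :: "('q, 'a) automaton \<Rightarrow> 'a list set" where
  "interval_language A = {w. \<exists>q \<in> initial A. \<exists>q' \<in> accepting A. path A q w q'}"

definition trace_language :: "('q, 'a) automaton \<Rightarrow> 'a list set" where
  "trace_language A = {w. \<exists>q \<in> states A. path A q w q}"

definition circular_arrangement :: "('q, 'a) automaton \<Rightarrow> 'q list \<Rightarrow> bool" where
  "circular_arrangement A qs \<longleftrightarrow> distinct qs \<and> set qs = states A"

(* qs lists the states in clockwise order, and Z/n is represented by {..<n}.  The second
   coordinate increases exactly when the arrow passes the base point of the circle between the
   last and the first state of qs. *)
definition cyclic_cover ::
  "('q, 'a) automaton \<Rightarrow> 'q list \<Rightarrow> nat \<Rightarrow> ('q \<times> nat, 'a) automaton" where
  "cyclic_cover A qs n =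
     \<lparr> alphabet = alphabet A,
       states = states A \<times> {..<n},
       delta = (\<lambda>(q, r) a. {(qs ! j, if i < j then r else (r + 1) mod n) | i j.
         i < length qs \<and> j < length qs \<and> qs ! i = q \<and> qs ! j \<in> delta A q a}),
       initial = initial A \<times> {..<n},
       accepting = accepting A \<times> {..<n} \<rparr>"

lemma nfa_cyclic_cover:
  assumes "nfa A" and "circular_arrangement A qs" and "n \<ge> 1"
  shows "nfa (cyclic_cover A qs n)"
  using assms by (fastforce simp: nfa_def cyclic_cover_def circular_arrangement_def)

end

theory Submission
  imports Defs
begin

text \<open>
  Count how often a path of \<open>A\<close> passes the base point of the circle; call this its winding
  \<open>m\<close>. Paths of the \<open>n\<close>-fold cyclic cover are then exactly pairs of a sheet \<open>r < n\<close> and a path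
  of \<open>A\<close>: the lift starts in sheet \<open>r\<close> and ends in sheet \<open>(r + m) mod n\<close>
  (\<open>path_cyclic_cover_iff\<close>). The rest follows from this description.

  \<^item> Being initial or accepting does not depend on the sheet, so the cover and \<open>A\<close> accept the
    same words.

  \<^item> A lift closes up iff the path of \<open>A\<close> closes up and \<open>n\<close> divides \<open>m\<close>. A path that never passes
    the base point advances strictly along the list of states, so a nonempty closed path has
    \<open>m > 0\<close>, hence \<open>n \<le> m\<close>. Each letter contributes at most one passage, so the word has length at
    least \<open>m\<close>, and therefore at least \<open>n\<close>.

  \<^item> Running \<open>n * k\<close> times around a cycle of \<open>A\<close> multiplies its winding by \<open>n * k\<close>, so the lift
    closes up for every \<open>k\<close>. This gives arbitrarily long words in the trace language.
\<close>

section \<open>Paths and their windings\<close>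

definition precedes :: "'q list \<Rightarrow> 'q \<Rightarrow> 'q \<Rightarrow> bool" where
  "precedes qs q q' \<longleftrightarrow> (\<exists>i j. i < j \<and> j < length qs \<and> qs ! i = q \<and> qs ! j = q')"

lemma precedes_nth_iff:
  assumes "distinct qs" "i < length qs" "j < length qs"
  shows "precedes qs (qs ! i) (qs ! j) \<longleftrightarrow> i < j"
  using assms unfolding precedes_def
  by (metis nth_eq_iff_index_eq order_less_trans)

lemma precedes_irrefl: "distinct qs \<Longrightarrow> \<not> precedes qs q q"
  unfolding precedes_def by (metis nth_eq_iff_index_eq order_less_trans less_irrefl)

lemma precedes_trans:
  assumes "distinct qs" "precedes qs p q" "precedes qs q r"
  shows "precedes qs p r"
proof -
  obtain i j where ij: "i < j" "j < length qs" "qs ! i = p" "qs ! j = q"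
    using assms(2) unfolding precedes_def by blast
  obtain j' k where jk: "j' < k" "k < length qs" "qs ! j' = q" "qs ! k = r"
    using assms(3) unfolding precedes_def by blast
  have "j = j'"
    using assms(1) ij jk by (metis nth_eq_iff_index_eq order_less_trans)
  with ij jk show ?thesis
    unfolding precedes_def by (metis order_less_trans)
qed

text \<open>
  The base point of the circle lies between the last and the first state of the list. An arrow
  makes at most one full rotation, so it passes the base point once unless it leads to a strictly
  later state; in particular a loop passes it once.
\<close>

definition passages :: "'q list \<Rightarrow> 'q \<Rightarrow> 'q \<Rightarrow> nat" where
  "passages qs q q' = (if precedes qs q q' then 0 else 1)"

inductive winding_path ::
  "('q, 'a) automaton \<Rightarrow> 'q list \<Rightarrow> 'q \<Rightarrow> 'a list \<Rightarrow> nat \<Rightarrow> 'q \<Rightarrow> bool"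
  for A :: "('q, 'a) automaton" and qs :: "'q list" where
  empty: "q \<in> states A \<Longrightarrow> winding_path A qs q [] 0 q"
| step: "(q, a, q') \<in> edges A \<Longrightarrow> winding_path A qs q' w m q'' \<Longrightarrow>
    winding_path A qs q (a # w) (passages qs q q' + m) q''"

lemma path_iff_winding_path: "path A q w q' \<longleftrightarrow> (\<exists>m. winding_path A qs q w m q')"
proof
  assume "path A q w q'"
  then show "\<exists>m. winding_path A qs q w m q'"
    by induction (blast intro: winding_path.intros)+
next
  assume "\<exists>m. winding_path A qs q w m q'"
  then obtain m where "winding_path A qs q w m q'" ..
  then show "path A q w q'"
    by induction (blast intro: path.intros)+
qed

lemma winding_path_start_in_states: "winding_path A qs q w m q' \<Longrightarrow> q \<in> states A"
  by (erule winding_path.cases) (auto simp: edges_def)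

lemma winding_le_length: "winding_path A qs q w m q' \<Longrightarrow> m \<le> length w"
  by (induction rule: winding_path.induct) (auto simp: passages_def)

text \<open>
  Without a passage every step leads to a strictly later state of the list. This is what rules
  out nonempty closed paths of winding 0, and so bounds the length of the words in the trace
  languages from below.
\<close>

lemma precedes_if_winding_0:
  assumes "winding_path A qs q w m q'" "distinct qs" "m = 0" "w \<noteq> []"
  shows "precedes qs q q'"
  using assms
proof induction
  case (step q a q' w m q'')
  then have first: "precedes qs q q'" and "m = 0"
    by (auto simp: passages_def split: if_splits)
  show ?case
  proof (cases "w = []")
    case True
    with step.hyps(2) have "q' = q''"
      by (auto elim: winding_path.cases)
    with first show ?thesis
      by simp
  next
    case False
    with step.IH \<open>distinct qs\<close> \<open>m = 0\<close> have "precedes qs q' q''"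
      by simp
    with first show ?thesis
      by (rule precedes_trans[OF \<open>distinct qs\<close>])
  qed
qed simp

lemma closed_winding_pos:
  assumes "winding_path A qs q w m q" "distinct qs" "w \<noteq> []"
  shows "m > 0"
  using precedes_if_winding_0[OF assms(1,2) _ assms(3)] precedes_irrefl[OF assms(2)] by auto

lemma winding_path_append:
  assumes "winding_path A qs p u l q" "winding_path A qs q v m r"
  shows "winding_path A qs p (u @ v) (l + m) r"
  using assms
  by (induction rule: winding_path.induct) (auto simp: add.assoc intro: winding_path.step)

lemma winding_path_power:
  assumes "winding_path A qs q w m q"
  shows "winding_path A qs q (concat (replicate k w)) (k * m) q"
proof (induction k)
  case 0
  show ?case
    using winding_path_start_in_states[OF assms] by (auto intro: winding_path.empty)
next
  case (Suc k)
  then show ?case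
    using winding_path_append[OF assms Suc.IH] by simp
qed


section \<open>Lifting paths to the cyclic covers\<close>

lemma edges_cyclic_cover_iff:
  assumes "nfa A" "circular_arrangement A qs"
  shows "((q, r), a, (q', s)) \<in> edges (cyclic_cover A qs n) \<longleftrightarrow>
    (q, a, q') \<in> edges A \<and> r < n \<and> s = (r + passages qs q q') mod n"
proof -
  have dist: "distinct qs" and set: "set qs = states A"
    using assms(2) by (auto simp: circular_arrangement_def)
  show ?thesis
  proof
    assume "((q, r), a, (q', s)) \<in> edges (cyclic_cover A qs n)"
    then show "(q, a, q') \<in> edges A \<and> r < n \<and> s = (r + passages qs q q') mod n"
      using dist by (auto simp: edges_def cyclic_cover_def passages_def precedes_nth_iff)
  next
    assume *: "(q, a, q') \<in> edges A \<and> r < n \<and> s = (r + passages qs q q') mod n"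
    then have "q \<in> states A" "q' \<in> states A"
      using assms(1) by (auto simp: edges_def nfa_def)
    then obtain i j where ij: "i < length qs" "qs ! i = q" "j < length qs" "qs ! j = q'"
      using set by (metis in_set_conv_nth)
    then have "s = (if i < j then r else (r + 1) mod n)"
      using * precedes_nth_iff[OF dist ij(1,3)] by (auto simp: passages_def)
    then have "(q', s) \<in> delta (cyclic_cover A qs n) (q, r) a"
      using * ij unfolding cyclic_cover_def edges_def by auto
    then show "((q, r), a, (q', s)) \<in> edges (cyclic_cover A qs n)"
      using * by (simp add: edges_def cyclic_cover_def)
  qed
qed

text \<open>
  Path lifting for the covering: the relation holds edge by edge, and both the shift between
  sheets and the winding add up along a path. All facts about the languages of the covers are
  read off from this equivalence.
\<close>

lemma path_cyclic_cover_iff: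
  assumes "nfa A" "circular_arrangement A qs"
  shows "path (cyclic_cover A qs n) (q, r) w (q', s) \<longleftrightarrow>
    r < n \<and> (\<exists>m. winding_path A qs q w m q' \<and> s = (r + m) mod n)"
proof
  assume "path (cyclic_cover A qs n) (q, r) w (q', s)"
  then show "r < n \<and> (\<exists>m. winding_path A qs q w m q' \<and> s = (r + m) mod n)"
  proof (induction "(q, r)" w "(q', s)" arbitrary: q r rule: path.induct)
    case empty
    then show ?case
      by (auto simp: cyclic_cover_def intro!: exI[of _ 0] winding_path.empty)
  next
    case (step a x w)
    obtain p t where x: "x = (p, t)"
      by (cases x)
    have e: "(q, a, p) \<in> edges A" "r < n" "t = (r + passages qs q p) mod n"
      using step.hyps(1) unfolding x edges_cyclic_cover_iff[OF assms] by auto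
    obtain m where "winding_path A qs p w m q'" "s = (t + m) mod n"
      using step.hyps(3)[OF x] by blast
    then have "winding_path A qs q (a # w) (passages qs q p + m) q'"
      and "s = (r + (passages qs q p + m)) mod n"
      using e by (auto intro: winding_path.step simp: mod_add_left_eq add.assoc)
    then show ?case
      using e(2) by blast
  qed
next
  assume "r < n \<and> (\<exists>m. winding_path A qs q w m q' \<and> s = (r + m) mod n)"
  then obtain m where "winding_path A qs q w m q'" "r < n" "s = (r + m) mod n"
    by blast
  then show "path (cyclic_cover A qs n) (q, r) w (q', s)"
  proof (induction arbitrary: r)
    case (empty q)
    then show ?case
      by (auto simp: cyclic_cover_def intro!: path.empty)
  next
    case (step q a p w m q'')
    let ?t = "(r + passages qs q p) mod n"
    have "path (cyclic_cover A qs n) (p, ?t) w (q'', s)"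
      using step by (intro step.IH) (auto simp: mod_add_left_eq add.assoc)
    moreover have "((q, r), a, (p, ?t)) \<in> edges (cyclic_cover A qs n)"
      using step by (simp add: edges_cyclic_cover_iff[OF assms])
    ultimately show ?case
      by (blast intro: path.step)
  qed
qed

lemma mem_trace_language_cyclic_cover_iff:
  assumes "nfa A" "circular_arrangement A qs" "n \<ge> 1"
  shows "w \<in> trace_language (cyclic_cover A qs n) \<longleftrightarrow>
    (\<exists>q m. winding_path A qs q w m q \<and> n dvd m)"
proof
  assume "w \<in> trace_language (cyclic_cover A qs n)"
  then obtain q r where "path (cyclic_cover A qs n) (q, r) w (q, r)"
    by (auto simp: trace_language_def)
  then obtain m where "r < n" "winding_path A qs q w m q" "r = (r + m) mod n"
    unfolding path_cyclic_cover_iff[OF assms(1,2)] by blast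
  then show "\<exists>q m. winding_path A qs q w m q \<and> n dvd m"
    by (metis add_diff_cancel_left' mod_eq_dvd_iff_nat le_add1 mod_less)
next
  assume "\<exists>q m. winding_path A qs q w m q \<and> n dvd m"
  then obtain q m where "winding_path A qs q w m q" "n dvd m"
    by blast
  then have "path (cyclic_cover A qs n) (q, 0) w (q, 0)" "q \<in> states A"
    using assms(3) path_cyclic_cover_iff[OF assms(1,2)] winding_path_start_in_states by fastforce+
  moreover from this have "(q, 0) \<in> states (cyclic_cover A qs n)"
    using assms(3) by (simp add: cyclic_cover_def)
  ultimately show "w \<in> trace_language (cyclic_cover A qs n)"
    unfolding trace_language_def by blast
qed


section \<open>The languages of the cyclic covers\<close>

lemma interval_language_cyclic_cover:
  assumes "nfa A" "circular_arrangement A qs" "n \<ge> 1"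
  shows "interval_language (cyclic_cover A qs n) = interval_language A"
proof (rule set_eqI)
  fix w
  have "w \<in> interval_language (cyclic_cover A qs n) \<longleftrightarrow>
    (\<exists>q \<in> initial A. \<exists>q' \<in> accepting A. \<exists>r<n. \<exists>s<n.
      path (cyclic_cover A qs n) (q, r) w (q', s))"
    by (auto simp: interval_language_def cyclic_cover_def)
  also have "\<dots> \<longleftrightarrow> (\<exists>q \<in> initial A. \<exists>q' \<in> accepting A. \<exists>m. winding_path A qs q w m q')"
    using assms(3) unfolding path_cyclic_cover_iff[OF assms(1,2)]
    by (metis less_le_trans mod_less_divisor zero_less_one)
  also have "\<dots> \<longleftrightarrow> w \<in> interval_language A"
    by (auto simp: interval_language_def path_iff_winding_path[of A _ _ _ qs])
  finally show "w \<in> interval_language (cyclic_cover A qs n) \<longleftrightarrow> w \<in> interval_language A" .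
qed

lemma length_ge_if_in_trace_language_cyclic_cover:
  assumes "nfa A" "circular_arrangement A qs" "n \<ge> 1"
    and "w \<in> trace_language (cyclic_cover A qs n)" "w \<noteq> []"
  shows "n \<le> length w"
proof -
  obtain q m where m: "winding_path A qs q w m q" "n dvd m"
    using assms(4) mem_trace_language_cyclic_cover_iff[OF assms(1-3)] by blast
  have "m > 0"
    using closed_winding_pos[OF m(1)] assms(2,5) by (simp add: circular_arrangement_def)
  then have "n \<le> m"
    using m(2) by (rule dvd_imp_le[rotated])
  also have "m \<le> length w"
    by (rule winding_le_length[OF m(1)])
  finally show ?thesis .
qed

lemma infinite_trace_language_cyclic_cover:
  assumes "nfa A" "circular_arrangement A qs" "n \<ge> 1" "has_oriented_cycle A"
  shows "infinite (trace_language (cyclic_cover A qs n))"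
proof -
  obtain q w m where w: "w \<noteq> []" and cycle: "winding_path A qs q w m q"
    using assms(4) by (auto simp: has_oriented_cycle_def path_iff_winding_path[of A _ _ _ qs])
  \<comment> \<open>A number of rounds divisible by \<open>n\<close> returns to the starting sheet, whatever the winding \<open>m\<close>.\<close>
  let ?word = "\<lambda>k. concat (replicate (n * k) w)"
  have "range ?word \<subseteq> trace_language (cyclic_cover A qs n)"
  proof clarify
    fix k
    have "winding_path A qs q (?word k) (n * k * m) q"
      by (rule winding_path_power[OF cycle])
    then show "?word k \<in> trace_language (cyclic_cover A qs n)"
      unfolding mem_trace_language_cyclic_cover_iff[OF assms(1-3)]
      by (metis dvd_triv_left mult.assoc)
  qed
  moreover have "inj ?word"
  proof (rule injI)
    fix k l
    assume "?word k = ?word l"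
    then have "length (?word k) = length (?word l)"
      by simp
    then show "k = l"
      using assms(3) w by (simp add: length_concat sum_list_replicate)
  qed
  ultimately show ?thesis
    by (meson infinite_super infinite_UNIV_nat finite_imageD)
qed

theorem proposition3p10:
  fixes A :: "('q, 'a) automaton" and qs :: "'q list"
  assumes "nfa A"
    and "has_oriented_cycle A"
    and "circular_arrangement A qs"
  shows "(\<forall>n\<ge>1. interval_language (cyclic_cover A qs n) = interval_language A) \<and>
    (\<forall>n\<ge>1. (\<forall>w \<in> trace_language (cyclic_cover A qs n). length w < n \<longrightarrow> w = []) \<and>
            infinite (trace_language (cyclic_cover A qs n)))"
  using interval_language_cyclic_cover[OF assms(1,3)]
    length_ge_if_in_trace_language_cyclic_cover[OF assms(1,3)]
    infinite_trace_language_cyclic_cover[OF assms(1,3) _ assms(2)]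
  by (meson not_le)

end
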